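(* Let $A$ be a sparse $n\times n$ matrix with a nested sequence of partitionings $\mathcal{P}_0,\dots,\mathcal{P}_l$, and run the hierarchical factorization algorithm (described in the context) on the $\mathcal{H}$-tree of $A$. Then at no point of its execution does the algorithm create an interaction edge between two nodes of the $\mathcal{H}$-tree whose distance is greater than $2$.
   Context: **Partitionings and adjacency graph.** A partitioning $\mathcal{P}$ is a surjective map $\{1,\dots,n\}\to\{1,\dots,n_{\mathcal{P}}\}$; its clusters are $C_j^{\mathcal{P}}=\{k:\mathcal{P}(k)=j\}$. $A_{i,j}$ denotes the submatrix of $A$ with rows in $C_i^{\mathcal{P}}$ and columns in $C_j^{\mathcal{P}}$. The adjacency graph of $A$ with partitioning $\mathcal{P}$ has vertices $v_1,\dots,v_{n_{\mathcal{P}}}$ and a directed edge $v_i\to v_j$ iff $A_{j,i}\neq 0$. Partitionings $\mathcal{P}_0,\dots,\mathcal{P}_l$ with $n_{\mathcal{P}_i}=2^i$ are nested if, for $0\le i<l$, every cluster $C_j^{\mathcal{P}_i}$ is the union of two clusters of $\mathcal{P}_{i+1}$ (its children, which are siblings of each other). Clusters of $\mathcal{P}_l$ are leaf clusters. A cluster $C_1$ is a descendant of a cluster $C_2$ iff $C_1\subseteq C_2$. **$\mathcal{H}$-tree.** For every $1\le i\le l$ and $1\le j\le 2^{i-1}$ there are: a black-node $b_j^{[i]}$ corresponding to the cluster $C_j^{\mathcal{P}_{i-1}}$; and two red-nodes ${r_0}_j^{[i]},{r_1}_j^{[i]}$ corresponding to the two children (clusters of $\mathcal{P}_i$) of $C_j^{\mathcal{P}_{i-1}}$.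 This pair of red-nodes is called the super-node $s_j^{[i]}$, which corresponds to $C_j^{\mathcal{P}_{i-1}}$. There is also one red-node corresponding to the root cluster (of $\mathcal{P}_0$). The superscript is the level. $\mathbb{P}(b_j^{[i]})$, the parent of $b_j^{[i]}$, is the red-node corresponding to $C_j^{\mathcal{P}_{i-1}}$. Each node carries a vector of variables and of equations, and each interaction edge $e_{u\to v}$ carries a matrix block $\mathrm{Mat}(e_{u\to v})$. Initially, interaction edges exist only between the level-$l$ red-nodes, which with these edges form the adjacency graph of $A$ with partitioning $\mathcal{P}_l$ (with the corresponding blocks of $A$). "Edge" means interaction edge. **Adjacency, well-separation, distance.** Two leaf clusters $C_p^{\mathcal{P}_l},C_q^{\mathcal{P}_l}$ are adjacent iff $A_{p,q}\ne0$ or $A_{q,p}\neq 0$. Two clusters (of any levels) are adjacent iff some leaf descendant of one is adjacent to some leaf descendant of the other. Two nodes of the $\mathcal{H}$-tree (red, black or super) are well-separated if their corresponding clusters are not adjacent; an edge joining two well-separated nodes is a well-separated edge. Distance: let nodes $u,v$ correspond to clusters $C_j^{\mathcal{P}_i}$ and $C_{j'}^{\mathcal{P}_{i'}}$ with $i\le i'$, and let $C_k^{\mathcal{P}_i}$ be the cluster of $\mathcal{P}_i$ containing $C_{j'}^{\mathcal{P}_{i'}}$. The distance between $u$ and $v$ is the number of edges of a shortest path between $v_j$ and $v_k$ in the adjacency graph of $A$ with partitioning $\mathcal{P}_i$, edge directions being ignored. Nodes are well-separated iff their distance is greater than $1$. **Algorithm.** For $i=l,l-1,\dots,1$: first, for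 $j=1,\dots,2^{i-1}$, apply MergeRedNodes$({r_0}_j^{[i]},{r_1}_j^{[i]})$, forming $s_j^{[i]}$; then, for $j=1,\dots,2^{i-1}$ in turn, apply Compress$(s_j^{[i]})$, Eliminate$(s_j^{[i]})$, Eliminate$(b_j^{[i]})$. - MergeRedNodes: the two red-nodes are replaced by the single node $s_j^{[i]}$ with concatenated variables and right-hand sides. All edges from the red-nodes of $s_j^{[i]}$ to those of $s_{j'}^{[i]}$ are replaced by one edge $s_j^{[i]}\to s_{j'}^{[i]}$ carrying the $2\times 2$ block matrix of their blocks (present iff at least one of the replaced edges is present). - Compress$(s)$, $s=s_j^{[i]}$ of size $m$: let $p_1,\dots,p_t$ be the not-yet-eliminated nodes joined to $s$ by well-separated edges (each is a super-node of level $i$ or a red-node of level $i-1$). Let $A_k=\mathrm{Mat}(e_{s\to p_k})$ and $B_k^{\top}=\mathrm{Mat}(e_{p_k\to s})$. Compute a low-rank approximation $[A_1;\dots;A_t;B_1;\dots;B_t]\simeq[R_1;\dots;R_t;Q_1;\dots;Q_t]V^{\top}$ (vertical concatenation), where $V$ is $m\times r$. Give the nodes $b=b_j^{[i]}$ and $\mathbb{P}(b)$ new variable vectors of size $r$. Remove all edges between $s$ and $p_1,\dots,p_t$; add edges $\mathbb{P}(b)\to p_k$ with block $R_k$ and $p_k\to\mathbb{P}(b)$ with block $Q_k^{\top}$ for each $k$; add edges $s\to b$ with block $V^{\top}$, $b\to s$ with block $V$, and $b\to\mathbb{P}(b)$, $\mathbb{P}(b)\to b$ with block $-I_r$. - Eliminate$(v)$: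 for every edge $e_{v\to w}$ and every edge $e_{u\to v}$ with $u,w\neq v$ not yet eliminated, add the block $-\mathrm{Mat}(e_{v\to w})\,\mathrm{Mat}(e_{v\to v})^{-1}\,\mathrm{Mat}(e_{u\to v})$ to the edge $e_{u\to w}$, creating that edge if it does not exist. The node $v$ is then eliminated, and takes no further part in the process. Pivot blocks $\mathrm{Mat}(e_{v\to v})$ are assumed invertible whenever used. *)

theory Defs
  imports
    "HOL-Library.Extended_Nat"
    "Jordan_Normal_Form.DL_Submatrix"
    "Jordan_Normal_Form.Gauss_Jordan_Elimination"
begin

text \<open>
  Matrix indices, clusters and cluster numbers are counted from 0, as in the matrix library:
  a partitioning of the indices into m clusters is a map from {0..<n} onto {0..<m}.
  Levels are counted as usual, with level 0 for the root cluster; P i is the partitioning of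
  level i, with 2 ^ i clusters.
\<close>

definition partitioning :: "nat \<Rightarrow> nat \<Rightarrow> (nat \<Rightarrow> nat) \<Rightarrow> bool" where
  "partitioning n m p \<longleftrightarrow> p ` {0..<n} = {0..<m}"

definition cluster :: "nat \<Rightarrow> (nat \<Rightarrow> nat \<Rightarrow> nat) \<Rightarrow> nat \<Rightarrow> nat \<Rightarrow> nat set" where
  "cluster n P i j = {k. k < n \<and> P i k = j}"

definition are_children :: "nat \<Rightarrow> (nat \<Rightarrow> nat \<Rightarrow> nat) \<Rightarrow> nat \<Rightarrow> nat \<Rightarrow> nat \<Rightarrow> nat \<Rightarrow> bool" where
  "are_children n P i j c0 c1 \<longleftrightarrow>
     c0 < 2 ^ Suc i \<and> c1 < 2 ^ Suc i \<and> c0 \<noteq> c1 \<and>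
     cluster n P i j = cluster n P (Suc i) c0 \<union> cluster n P (Suc i) c1"

definition nested_partitionings :: "nat \<Rightarrow> nat \<Rightarrow> (nat \<Rightarrow> nat \<Rightarrow> nat) \<Rightarrow> bool" where
  "nested_partitionings n l P \<longleftrightarrow>
     (\<forall>i\<le>l. partitioning n (2 ^ i) (P i)) \<and>
     (\<forall>i<l. \<forall>j<2 ^ i. \<exists>c0 c1. are_children n P i j c0 c1)"

definition block :: "nat \<Rightarrow> (nat \<Rightarrow> nat \<Rightarrow> nat) \<Rightarrow> 'a mat \<Rightarrow> nat \<Rightarrow> nat \<Rightarrow> nat \<Rightarrow> 'a mat" where
  "block n P A i p q = submatrix A (cluster n P i p) (cluster n P i q)"

definition nonzero_block ::
    "nat \<Rightarrow> (nat \<Rightarrow> nat \<Rightarrow> nat) \<Rightarrow> 'a::zero mat \<Rightarrow> nat \<Rightarrow> nat \<Rightarrow> nat \<Rightarrow> bool" where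
  "nonzero_block n P A i p q \<longleftrightarrow>
     block n P A i p q \<noteq> 0\<^sub>m (card (cluster n P i p)) (card (cluster n P i q))"

definition adjacency_graph ::
    "nat \<Rightarrow> (nat \<Rightarrow> nat \<Rightarrow> nat) \<Rightarrow> 'a::zero mat \<Rightarrow> nat \<Rightarrow> (nat \<times> nat) set" where
  "adjacency_graph n P A i =
     {(p, q). p < 2 ^ i \<and> q < 2 ^ i \<and> nonzero_block n P A i q p}"

text \<open>
  Length of a shortest path, edge directions being ignored; it is \<open>\<infinity>\<close> if there is no path.
\<close>

definition graph_distance :: "(nat \<times> nat) set \<Rightarrow> nat \<Rightarrow> nat \<Rightarrow> enat" where
  "graph_distance G p q = Inf {enat d |d. (p, q) \<in> (G \<union> G\<inverse>) ^^ d}"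

definition adjacent_leaves ::
    "nat \<Rightarrow> nat \<Rightarrow> (nat \<Rightarrow> nat \<Rightarrow> nat) \<Rightarrow> 'a::zero mat \<Rightarrow> nat \<Rightarrow> nat \<Rightarrow> bool" where
  "adjacent_leaves n l P A p q \<longleftrightarrow> nonzero_block n P A l p q \<or> nonzero_block n P A l q p"

definition adjacent_clusters ::
    "nat \<Rightarrow> nat \<Rightarrow> (nat \<Rightarrow> nat \<Rightarrow> nat) \<Rightarrow> 'a::zero mat \<Rightarrow> nat set \<Rightarrow> nat set \<Rightarrow> bool" where
  "adjacent_clusters n l P A C D \<longleftrightarrow>
     (\<exists>p<2 ^ l. \<exists>q<2 ^ l. cluster n P l p \<subseteq> C \<and> cluster n P l q \<subseteq> D \<and>
        adjacent_leaves n l P A p q)"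

text \<open>
  \<open>Red i c\<close> is the red-node of level i corresponding to the cluster c of \<open>P i\<close>.
  The two red-nodes of a super-node \<open>Super i j\<close> are thus \<open>Red i c0\<close> and \<open>Red i c1\<close>,
  where c0 and c1 are the children of the cluster j of \<open>P (i - 1)\<close>.
\<close>

datatype node = Red nat nat | Black nat nat | Super nat nat

fun cluster_level :: "node \<Rightarrow> nat" where
  "cluster_level (Red i c) = i"
| "cluster_level (Black i j) = i - 1"
| "cluster_level (Super i j) = i - 1"

fun cluster_index :: "node \<Rightarrow> nat" where
  "cluster_index (Red i c) = c"
| "cluster_index (Black i j) = j"
| "cluster_index (Super i j) = j"

definition cluster_of :: "nat \<Rightarrow> (nat \<Rightarrow> nat \<Rightarrow> nat) \<Rightarrow> node \<Rightarrow> nat set" where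
  "cluster_of n P u = cluster n P (cluster_level u) (cluster_index u)"

definition well_separated ::
    "nat \<Rightarrow> nat \<Rightarrow> (nat \<Rightarrow> nat \<Rightarrow> nat) \<Rightarrow> 'a::zero mat \<Rightarrow> node \<Rightarrow> node \<Rightarrow> bool" where
  "well_separated n l P A u v \<longleftrightarrow>
     \<not> adjacent_clusters n l P A (cluster_of n P u) (cluster_of n P v)"

definition containing_cluster :: "nat \<Rightarrow> (nat \<Rightarrow> nat \<Rightarrow> nat) \<Rightarrow> nat \<Rightarrow> node \<Rightarrow> nat" where
  "containing_cluster n P i v = (THE k. k < 2 ^ i \<and> cluster_of n P v \<subseteq> cluster n P i k)"

definition distance ::
    "nat \<Rightarrow> (nat \<Rightarrow> nat \<Rightarrow> nat) \<Rightarrow> 'a::zero mat \<Rightarrow> node \<Rightarrow> node \<Rightarrow> enat" where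
  "distance n P A u v =
     (let i = min (cluster_level u) (cluster_level v)
      in graph_distance (adjacency_graph n P A i)
           (containing_cluster n P i u) (containing_cluster n P i v))"

text \<open>
  \<open>edge S u v\<close> is the block carried by the interaction edge from u to v, or None if there is no
  such edge. It has one row for each equation of v and one column for each variable of u.
  \<open>node_size S u\<close> is the number of variables, and of equations, of the node u.
  Edges of an eliminated node are kept, but no later operation reads or changes them.
\<close>

record 'a state =
  node_size :: "node \<Rightarrow> nat"
  edge :: "node \<Rightarrow> node \<Rightarrow> 'a mat option"
  eliminated :: "node set"

definition has_edge :: "'a state \<Rightarrow> node \<Rightarrow> node \<Rightarrow> bool" where
  "has_edge S u v \<longleftrightarrow> edge S u v \<noteq> None"

text \<open>The block of an edge; a missing edge counts as a zero block.\<close>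

definition Mat :: "'a::zero state \<Rightarrow> node \<Rightarrow> node \<Rightarrow> 'a mat" where
  "Mat S u v =
     (case edge S u v of None \<Rightarrow> 0\<^sub>m (node_size S v) (node_size S u) | Some M \<Rightarrow> M)"

text \<open>The edge from \<open>v\<^sub>i\<close> to \<open>v\<^sub>j\<close> of the adjacency graph carries the block \<open>A\<^sub>j\<^sub>i\<close>.\<close>

fun initial_edge ::
    "nat \<Rightarrow> nat \<Rightarrow> (nat \<Rightarrow> nat \<Rightarrow> nat) \<Rightarrow> 'a::zero mat \<Rightarrow> node \<Rightarrow> node \<Rightarrow> 'a mat option" where
  "initial_edge n l P A (Red i p) (Red i' q) =
     (if i = l \<and> i' = l \<and> (p, q) \<in> adjacency_graph n P A l then Some (block n P A l q p) else None)"
| "initial_edge n l P A _ _ = None"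

definition initial_state ::
    "nat \<Rightarrow> nat \<Rightarrow> (nat \<Rightarrow> nat \<Rightarrow> nat) \<Rightarrow> 'a::zero mat \<Rightarrow> 'a state" where
  "initial_state n l P A =
     \<lparr> node_size = (\<lambda>u. case u of Red i c \<Rightarrow> if i = l then card (cluster n P l c) else 0 | _ \<Rightarrow> 0),
       edge = initial_edge n l P A,
       eliminated = {} \<rparr>"

definition append_cols :: "'a::zero mat \<Rightarrow> 'a mat \<Rightarrow> 'a mat" where
  "append_cols M N = transpose_mat (transpose_mat M @\<^sub>r transpose_mat N)"

text \<open>
  The red-nodes r0 and r1 are replaced by s. Super-nodes of a level are formed one after the other:
  each merge concatenates blocks at the ends that belong to s. As soon as both ends of an edge
  have been merged, the edge from s to s' carries the 2 x 2 block matrix of the four blocks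
  between their red-nodes, and it is present iff one of the four edges was.
\<close>

definition parts :: "node \<Rightarrow> node \<Rightarrow> node \<Rightarrow> node \<Rightarrow> node set" where
  "parts s r0 r1 u = (if u = s then {r0, r1} else {u})"

definition merged_block :: "'a::zero state \<Rightarrow> node \<Rightarrow> node \<Rightarrow> node \<Rightarrow> node \<Rightarrow> node \<Rightarrow> 'a mat" where
  "merged_block S s r0 r1 u w =
     (let into = (\<lambda>x. if u = s then append_cols (Mat S r0 x) (Mat S r1 x) else Mat S u x)
      in if w = s then into r0 @\<^sub>r into r1 else into w)"

definition merge_red_nodes :: "'a::zero state \<Rightarrow> node \<Rightarrow> node \<Rightarrow> node \<Rightarrow> 'a state" where
  "merge_red_nodes S s r0 r1 = S
     \<lparr> node_size := (node_size S)(s := node_size S r0 + node_size S r1),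
       edge := (\<lambda>u w.
         if u \<in> eliminated S \<or> w \<in> eliminated S then edge S u w
         else if u \<in> {r0, r1} \<or> w \<in> {r0, r1} then None
         else if \<exists>u'\<in>parts s r0 r1 u. \<exists>w'\<in>parts s r0 r1 w. has_edge S u' w'
           then Some (merged_block S s r0 r1 u w)
         else None) \<rparr>"

text \<open>
  A cluster whose diagonal block vanishes need not be adjacent to itself; the condition \<open>p \<noteq> s\<close>
  keeps a self-loop of s from counting as a well-separated edge.
\<close>

definition well_separated_neighbours ::
    "nat \<Rightarrow> nat \<Rightarrow> (nat \<Rightarrow> nat \<Rightarrow> nat) \<Rightarrow> 'a::zero mat \<Rightarrow> 'a state \<Rightarrow> node \<Rightarrow> node set" where
  "well_separated_neighbours n l P A S s =
     {p. p \<notin> eliminated S \<and> p \<noteq> s \<and> (has_edge S s p \<or> has_edge S p s) \<and> well_separated n l P A s p}"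

definition vstack :: "nat \<Rightarrow> 'a::zero mat list \<Rightarrow> 'a mat" where
  "vstack m Ms = foldr append_rows Ms (0\<^sub>m 0 m)"

text \<open>
  \<open>approx M N\<close> says that N is accepted as an approximation of M. The algorithm does not fix the
  criterion, so it is a parameter. The factors, and their inner dimension r, may be any that meet it.
\<close>

definition low_rank_approximation ::
    "('a::field mat \<Rightarrow> 'a mat \<Rightarrow> bool) \<Rightarrow> 'a state \<Rightarrow> node \<Rightarrow> node list \<Rightarrow> nat \<Rightarrow>
      (node \<Rightarrow> 'a mat) \<Rightarrow> (node \<Rightarrow> 'a mat) \<Rightarrow> 'a mat \<Rightarrow> bool" where
  "low_rank_approximation approx S s ps r R Q V \<longleftrightarrow>
     (\<forall>p\<in>set ps. R p \<in> carrier_mat (node_size S p) r \<and> Q p \<in> carrier_mat (node_size S p) r) \<and>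
     V \<in> carrier_mat (node_size S s) r \<and>
     approx
       (vstack (node_size S s) (map (\<lambda>p. Mat S s p) ps @ map (\<lambda>p. transpose_mat (Mat S p s)) ps))
       (vstack r (map R ps @ map Q ps) * transpose_mat V)"

definition compressed ::
    "'a::field state \<Rightarrow> node \<Rightarrow> node \<Rightarrow> node \<Rightarrow> node set \<Rightarrow> nat \<Rightarrow>
      (node \<Rightarrow> 'a mat) \<Rightarrow> (node \<Rightarrow> 'a mat) \<Rightarrow> 'a mat \<Rightarrow> 'a state" where
  "compressed S s b pb ps r R Q V = S
     \<lparr> node_size := (node_size S)(b := r, pb := r),
       edge := (\<lambda>u w.
         if u = s \<and> w \<in> ps \<or> u \<in> ps \<and> w = s then None
         else if u = pb \<and> w \<in> ps then Some (R w)
         else if u \<in> ps \<and> w = pb then Some (transpose_mat (Q u))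
         else if u = s \<and> w = b then Some (transpose_mat V)
         else if u = b \<and> w = s then Some V
         else if u = b \<and> w = pb \<or> u = pb \<and> w = b then Some (- 1\<^sub>m r)
         else edge S u w) \<rparr>"

text \<open>The pivot block is used only if v has an incoming and an outgoing edge.\<close>

definition in_neighbours :: "'a state \<Rightarrow> node \<Rightarrow> node set" where
  "in_neighbours S v = {u. u \<noteq> v \<and> u \<notin> eliminated S \<and> has_edge S u v}"

definition out_neighbours :: "'a state \<Rightarrow> node \<Rightarrow> node set" where
  "out_neighbours S v = {w. w \<noteq> v \<and> w \<notin> eliminated S \<and> has_edge S v w}"

definition pivot_ok :: "'a::field state \<Rightarrow> node \<Rightarrow> bool" where
  "pivot_ok S v \<longleftrightarrow>
     (in_neighbours S v \<noteq> {} \<and> out_neighbours S v \<noteq> {} \<longrightarrow> invertible_mat (Mat S v v))"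

definition eliminate :: "'a::field state \<Rightarrow> node \<Rightarrow> 'a state" where
  "eliminate S v = S
     \<lparr> edge := (\<lambda>u w.
         if u \<in> in_neighbours S v \<and> w \<in> out_neighbours S v
         then Some (Mat S u w + - (Mat S v w * the (mat_inverse (Mat S v v)) * Mat S u v))
         else edge S u w),
       eliminated := insert v (eliminated S) \<rparr>"

text \<open>\<open>MergeRedNodes i j\<close> and \<open>Compress i j\<close> are the operations concerning \<open>Super i j\<close>.\<close>

datatype operation = MergeRedNodes nat nat | Compress nat nat | Eliminate node

definition schedule :: "nat \<Rightarrow> operation list" where
  "schedule l = concat (map (\<lambda>i.
       map (MergeRedNodes i) [0..<2 ^ (i - 1)] @
       concat (map (\<lambda>j. [Compress i j, Eliminate (Super i j), Eliminate (Black i j)])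
         [0..<2 ^ (i - 1)]))
     (rev [1..<Suc l]))"

inductive step ::
    "('a::field mat \<Rightarrow> 'a mat \<Rightarrow> bool) \<Rightarrow> nat \<Rightarrow> nat \<Rightarrow> (nat \<Rightarrow> nat \<Rightarrow> nat) \<Rightarrow> 'a mat \<Rightarrow>
      operation \<Rightarrow> 'a state \<Rightarrow> 'a state \<Rightarrow> bool"
  for approx n l P A where
  merge: "are_children n P (i - 1) j c0 c1 \<Longrightarrow>
    step approx n l P A (MergeRedNodes i j) S (merge_red_nodes S (Super i j) (Red i c0) (Red i c1))"
| compress: "distinct ps \<Longrightarrow> set ps = well_separated_neighbours n l P A S (Super i j) \<Longrightarrow>
    low_rank_approximation approx S (Super i j) ps r R Q V \<Longrightarrow>
    step approx n l P A (Compress i j) S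
      (compressed S (Super i j) (Black i j) (Red (i - 1) j) (set ps) r R Q V)"
| eliminate: "pivot_ok S v \<Longrightarrow> step approx n l P A (Eliminate v) S (eliminate S v)"

text \<open>
  The successive states of a complete or interrupted execution, from the initial state on.
\<close>

definition execution ::
    "('a::field mat \<Rightarrow> 'a mat \<Rightarrow> bool) \<Rightarrow> nat \<Rightarrow> nat \<Rightarrow> (nat \<Rightarrow> nat \<Rightarrow> nat) \<Rightarrow> 'a mat \<Rightarrow>
      'a state list \<Rightarrow> bool" where
  "execution approx n l P A Ss \<longleftrightarrow>
     Ss \<noteq> [] \<and> hd Ss = initial_state n l P A \<and> length Ss \<le> Suc (length (schedule l)) \<and>
     (\<forall>k. Suc k < length Ss \<longrightarrow> step approx n l P A (schedule l ! k) (Ss ! k) (Ss ! Suc k))"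

definition creates_edge :: "'a state \<Rightarrow> 'a state \<Rightarrow> node \<Rightarrow> node \<Rightarrow> bool" where
  "creates_edge S S' u v \<longleftrightarrow> \<not> has_edge S u v \<and> has_edge S' u v"

end

theory Submission
  imports Defs
begin

text \<open>
  Call two clusters of one level near if they are equal or joined by an edge of the adjacency
  graph of that level; distance at most 2 means that some cluster is near to both. While level
  \<open>Suc r\<close> is processed, the invariant is that the ends of every edge between nodes that are not
  eliminated lie in clusters of level \<open>r\<close> at distance at most 2.

  Fill-in arises only by elimination, which joins any two neighbours of the pivot. So it suffices
  that at the moment of elimination all neighbours of the pivot are near to it: the triangle
  inequality bounds the distance of two neighbours by 2. Compression establishes exactly this.
  It removes every well-separated edge of the super-node and hands it to the parent of its
  black-node, which corresponds to the same cluster, so distances do not change. What is left at the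
  super-node are nodes not well-separated from it, hence near, and the new black-node. The
  black-node is joined only to the super-node and its parent, all three having the same cluster.
  Thus the elimination of the super-node leaves the black-node with near neighbours only, and its
  elimination is harmless too (\<open>confined_compressed\<close>, \<open>confined_eliminate\<close>,
  \<open>near_only_eliminate\<close>).

  Merging, and the passage from one level to the next, replace clusters by their parents. A
  nonzero block lies in a nonzero block of the parents, so parents of near clusters are
  near, and distances never grow (\<open>near_coarsen\<close>). For this step the surviving nodes must be known,
  so the invariant also records the set of nodes that carry edges at each moment.
\<close>

section \<open>Nonzero blocks\<close>

lemma nonzero_blockI:
  assumes "A \<in> carrier_mat n n" "a < n" "b < n" "A $$ (a, b) \<noteq> 0"
  shows "nonzero_block n P A i (P i a) (P i b)"
  unfolding nonzero_block_def
proof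
  let ?I = "cluster n P i (P i a)" and ?J = "cluster n P i (P i b)"
  let ?a = "card {x \<in> ?I. x < a}" and ?b = "card {x \<in> ?J. x < b}"
  assume "block n P A i (P i a) (P i b) = 0\<^sub>m (card ?I) (card ?J)"
  moreover have "a \<in> ?I" "b \<in> ?J"
    using assms by (auto simp: cluster_def)
  moreover from this have "block n P A i (P i a) (P i b) $$ (?a, ?b) = A $$ (a, b)"
    unfolding block_def using assms by (intro submatrix_index_card) auto
  moreover have "?a < card ?I" "?b < card ?J"
    using \<open>a \<in> ?I\<close> \<open>b \<in> ?J\<close> by (auto intro!: psubset_card_mono simp: cluster_def)
  ultimately show False
    using assms(4) by simp
qed

lemma nonzero_blockE:
  assumes "A \<in> carrier_mat n n" "nonzero_block n P A i p q"
  obtains a b where "a < n" "b < n" "P i a = p" "P i b = q" "A $$ (a, b) \<noteq> 0"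
proof -
  let ?I = "cluster n P i p" and ?J = "cluster n P i q"
  have dims: "{k. k < dim_row A \<and> k \<in> ?I} = ?I" "{k. k < dim_col A \<and> k \<in> ?J} = ?J"
    using assms(1) by (auto simp: cluster_def)
  have "\<exists>x<card ?I. \<exists>y<card ?J. block n P A i p q $$ (x, y) \<noteq> 0"
  proof (rule ccontr)
    assume "\<not> ?thesis"
    then have "block n P A i p q = 0\<^sub>m (card ?I) (card ?J)"
      by (intro eq_matI) (auto simp: block_def dim_submatrix dims)
    with assms(2) show False
      by (simp add: nonzero_block_def)
  qed
  then obtain x y where xy: "x < card ?I" "y < card ?J" "block n P A i p q $$ (x, y) \<noteq> 0"
    by blast
  have "pick ?I x \<in> ?I" "pick ?J y \<in> ?J"
    using xy by (auto intro: pick_in_set_le)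
  moreover have "A $$ (pick ?I x, pick ?J y) \<noteq> 0"
    using xy by (simp add: block_def submatrix_index dims)
  ultimately show thesis
    using that by (auto simp: cluster_def)
qed

section \<open>Near clusters\<close>

locale nested_matrix =
  fixes n l :: nat and P :: "nat \<Rightarrow> nat \<Rightarrow> nat" and A :: "'a::field mat"
    and approx :: "'a mat \<Rightarrow> 'a mat \<Rightarrow> bool"
  assumes carrier: "A \<in> carrier_mat n n"
    and nested: "nested_partitionings n l P"
begin

definition near :: "nat \<Rightarrow> (nat \<times> nat) set" where
  "near r = (adjacency_graph n P A r \<union> (adjacency_graph n P A r)\<inverse>)\<^sup>="

abbreviation near2 :: "nat \<Rightarrow> (nat \<times> nat) set" where
  "near2 r \<equiv> near r O near r"

lemma near_refl: "(p, p) \<in> near r"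
  by (simp add: near_def)

lemma near_sym: "(p, q) \<in> near r \<Longrightarrow> (q, p) \<in> near r"
  by (auto simp: near_def)

lemma near2_refl: "(p, p) \<in> near2 r"
  using near_refl by blast

lemma near2_sym: "(p, q) \<in> near2 r \<Longrightarrow> (q, p) \<in> near2 r"
  using near_sym by blast

lemma part_less:
  assumes "r \<le> l" "x < n"
  shows "P r x < 2 ^ r"
proof -
  have "P r ` {0..<n} = {0..<2 ^ r}"
    using nested assms by (auto simp: nested_partitionings_def partitioning_def)
  then show ?thesis
    using assms by force
qed

lemma part_onto:
  assumes "r \<le> l" "c < 2 ^ r"
  obtains x where "x < n" "P r x = c"
proof -
  have "P r ` {0..<n} = {0..<2 ^ r}"
    using nested assms by (auto simp: nested_partitionings_def partitioning_def)
  then show ?thesis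
    using assms that by (metis atLeastLessThan_iff imageE le0)
qed

lemma entry_near:
  assumes "r \<le> l" "a < n" "b < n" "A $$ (a, b) \<noteq> 0"
  shows "(P r a, P r b) \<in> near r"
  using assms nonzero_blockI[OF carrier assms(2-4)] part_less
  by (auto simp: near_def adjacency_graph_def)

lemma near_cases:
  assumes "(p, q) \<in> near r"
  obtains "p = q"
  | a b where "a < n" "b < n" "P r a = p" "P r b = q" "A $$ (a, b) \<noteq> 0 \<or> A $$ (b, a) \<noteq> 0"
  using assms unfolding near_def adjacency_graph_def
  by (auto elim!: nonzero_blockE[OF carrier])

abbreviation anc :: "nat \<Rightarrow> node \<Rightarrow> nat" where
  "anc r v \<equiv> containing_cluster n P r v"

text \<open>A common index is what makes the containing cluster unique.\<close>

lemma anc_eqI: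
  assumes "x \<in> cluster_of n P v" "cluster_of n P v \<subseteq> cluster n P r j" "j < 2 ^ r"
  shows "anc r v = j"
  unfolding containing_cluster_def
proof (rule the_equality)
  show "j < 2 ^ r \<and> cluster_of n P v \<subseteq> cluster n P r j"
    using assms by simp
next
  fix k
  assume "k < 2 ^ r \<and> cluster_of n P v \<subseteq> cluster n P r k"
  then have "x \<in> cluster n P r k" "x \<in> cluster n P r j"
    using assms by auto
  then show "k = j"
    by (simp add: cluster_def)
qed

lemma anc_same_level:
  assumes "cluster_level v = r" "cluster_index v < 2 ^ r" "r \<le> l"
  shows "anc r v = cluster_index v"
proof -
  obtain x where "x < n" "P r x = cluster_index v"
    using part_onto assms by blast
  then have "x \<in> cluster_of n P v"
    using assms by (simp add: cluster_of_def cluster_def)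
  then show ?thesis
    using assms by (intro anc_eqI) (auto simp: cluster_of_def)
qed

lemma anc_child:
  assumes "are_children n P r j c0 c1" "j < 2 ^ r" "r < l" "c \<in> {c0, c1}"
  shows "anc r (Red (Suc r) c) = j"
proof -
  have "c < 2 ^ Suc r" "cluster n P (Suc r) c \<subseteq> cluster n P r j"
    using assms by (auto simp: are_children_def)
  moreover from this obtain x where "x < n" "P (Suc r) x = c"
    using part_onto assms by (metis Suc_leI)
  ultimately show ?thesis
    using assms by (intro anc_eqI[of x]) (auto simp: cluster_of_def cluster_def)
qed

lemma anc_part:
  assumes "r < l" "x < n"
  shows "anc r (Red (Suc r) (P (Suc r) x)) = P r x"
proof -
  have less: "P r x < 2 ^ r"
    using part_less assms by simp
  then obtain c0 c1 where ch: "are_children n P r (P r x) c0 c1"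
    using nested assms unfolding nested_partitionings_def by blast
  have "x \<in> cluster n P r (P r x)"
    using assms by (simp add: cluster_def)
  then have "P (Suc r) x \<in> {c0, c1}"
    using ch by (auto simp: are_children_def cluster_def)
  then show ?thesis
    using anc_child[OF ch less assms(1)] by blast
qed

lemma anc_less:
  assumes "r < l" "c < 2 ^ Suc r"
  shows "anc r (Red (Suc r) c) < 2 ^ r"
proof -
  obtain x where "x < n" "P (Suc r) x = c"
    using part_onto[of "Suc r" c] assms by (metis Suc_leI)
  then show ?thesis
    using anc_part part_less assms by (metis less_imp_le)
qed

lemma child_cases:
  assumes "are_children n P r (anc r (Red (Suc r) c)) c0 c1" "r < l" "c < 2 ^ Suc r"
  shows "c = c0 \<or> c = c1"
proof -
  obtain x where x: "x < n" "P (Suc r) x = c"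
    using part_onto[of "Suc r" c] assms by (metis Suc_leI)
  then have "x \<in> cluster n P r (anc r (Red (Suc r) c))"
    using anc_part[OF assms(2) x(1)] by (simp add: cluster_def)
  then show ?thesis
    using assms(1) x by (auto simp: are_children_def cluster_def)
qed

text \<open>
  The nonzero entry that joins two clusters also lies in the block of their parents. The parents may
  coincide, which is why nearness includes equality.
\<close>

lemma near_coarsen:
  assumes "r < l" "(c, d) \<in> near (Suc r)"
  shows "(anc r (Red (Suc r) c), anc r (Red (Suc r) d)) \<in> near r"
  using assms(2)
proof (cases rule: near_cases)
  case 1
  then show ?thesis
    by (simp add: near_refl)
next
  case (2 a b)
  have "(P r a, P r b) \<in> near r"
    using entry_near[of r a b] entry_near[of r b a] 2 assms(1) near_sym by auto
  then show ?thesis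
    using anc_part[OF assms(1)] 2 by metis
qed

lemma near2_coarsen:
  assumes "r < l" "(c, d) \<in> near2 (Suc r)"
  shows "(anc r (Red (Suc r) c), anc r (Red (Suc r) d)) \<in> near2 r"
  using assms(2) near_coarsen[OF assms(1)] by blast

text \<open>
  Well-separation is tested on leaf clusters. A nonzero block between leaves inside two clusters of
  level \<open>r\<close> contains an entry that also makes the block of these clusters nonzero.
\<close>

lemma near_if_not_well_separated:
  assumes "\<not> well_separated n l P A u v" "r \<le> l"
    and "cluster_level u = r" "cluster_index u < 2 ^ r"
    and "cluster_level v = r" "cluster_index v < 2 ^ r"
  shows "(anc r u, anc r v) \<in> near r"
proof -
  obtain p q where sub: "cluster n P l p \<subseteq> cluster_of n P u" "cluster n P l q \<subseteq> cluster_of n P v"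
    and adj: "adjacent_leaves n l P A p q"
    using assms(1) by (auto simp: well_separated_def adjacent_clusters_def)
  obtain a b where ab: "a < n" "b < n" "P l a = p" "P l b = q"
    and entry: "A $$ (a, b) \<noteq> 0 \<or> A $$ (b, a) \<noteq> 0"
    using adj unfolding adjacent_leaves_def by (metis nonzero_blockE[OF carrier])
  have "a \<in> cluster_of n P u" "b \<in> cluster_of n P v"
    using sub ab by (auto simp: cluster_def)
  then have "P r a = cluster_index u" "P r b = cluster_index v"
    using assms by (auto simp: cluster_of_def cluster_def)
  moreover have "(P r a, P r b) \<in> near r"
    using entry entry_near[of r a b] entry_near[of r b a] ab assms(2) near_sym by auto
  ultimately show ?thesis
    using assms by (simp add: anc_same_level)
qed

lemma distance_le_2:
  assumes "min (cluster_level u) (cluster_level v) = r" "(anc r u, anc r v) \<in> near2 r"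
  shows "distance n P A u v \<le> 2"
proof -
  let ?G = "adjacency_graph n P A r \<union> (adjacency_graph n P A r)\<inverse>"
  have "\<exists>d\<le>2. (anc r u, anc r v) \<in> ?G ^^ d"
  proof -
    obtain m where "(anc r u, m) \<in> ?G\<^sup>=" "(m, anc r v) \<in> ?G\<^sup>="
      using assms(2) by (auto simp: near_def)
    then consider "anc r u = anc r v" | "(anc r u, anc r v) \<in> ?G"
      | "(anc r u, m) \<in> ?G" "(m, anc r v) \<in> ?G"
      by auto
    then show ?thesis
    proof cases
      case 1
      then show ?thesis by (intro exI[of _ 0]) simp
    next
      case 2
      then show ?thesis by (intro exI[of _ 1]) simp
    next
      case 3
      then have "(anc r u, anc r v) \<in> ?G ^^ 2"
        by (auto simp: numeral_2_eq_2)
      then show ?thesis by blast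
    qed
  qed
  then obtain d where d: "d \<le> 2" "(anc r u, anc r v) \<in> ?G ^^ d"
    by blast
  have "distance n P A u v \<le> enat d"
    unfolding distance_def graph_distance_def Let_def assms(1) using d(2) by (auto intro: Inf_lower)
  also have "\<dots> \<le> 2"
    using d(1) by (simp add: numeral_eq_enat)
  finally show ?thesis .
qed

section \<open>Runs whose new edges are short\<close>

text \<open>
  This is a weakest precondition. Since it composes along concatenations and loops
  (\<open>safe_append\<close>, \<open>safe_loop\<close>), the nested loops of the schedule can be handled by loop invariants
  instead of positions in the list of operations.
\<close>

primrec safe :: "operation list \<Rightarrow> ('a state \<Rightarrow> bool) \<Rightarrow> 'a state \<Rightarrow> bool" where
  "safe [] J S \<longleftrightarrow> J S"
| "safe (p # ps) J S \<longleftrightarrow>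
     (\<forall>S'. step approx n l P A p S S' \<longrightarrow>
        (\<forall>u v. creates_edge S S' u v \<longrightarrow> distance n P A u v \<le> 2) \<and> safe ps J S')"

lemma safe_Cons:
  assumes "\<And>S'. step approx n l P A p S S' \<Longrightarrow>
      (\<forall>u v. creates_edge S S' u v \<longrightarrow> distance n P A u v \<le> 2) \<and> I S'"
    and "\<And>S'. I S' \<Longrightarrow> safe ps J S'"
  shows "safe (p # ps) J S"
  using assms by simp

lemma safe_append: "safe (ps @ qs) J S \<longleftrightarrow> safe ps (safe qs J) S"
  by (induction ps arbitrary: S) auto

lemma safe_mono: "safe ps J S \<Longrightarrow> (\<And>S. J S \<Longrightarrow> J' S) \<Longrightarrow> safe ps J' S"
  by (induction ps arbitrary: S) auto

lemma safe_loop: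
  assumes "\<And>j S. j < m \<Longrightarrow> I j S \<Longrightarrow> safe (f j) (I (Suc j)) S" "I 0 S"
  shows "safe (concat (map f [0..<m])) (I m) S"
  using assms
proof (induction m)
  case 0
  then show ?case by simp
next
  case (Suc m)
  then have "safe (concat (map f [0..<m])) (I m) S"
    by simp
  then show ?case
    using Suc.prems(1) by (auto simp: safe_append intro: safe_mono)
qed

lemma safe_run:
  assumes "safe ps J (Ss ! 0)" "length Ss \<le> Suc (length ps)"
    and "\<And>k. Suc k < length Ss \<Longrightarrow> step approx n l P A (ps ! k) (Ss ! k) (Ss ! Suc k)"
    and "Suc k < length Ss" "creates_edge (Ss ! k) (Ss ! Suc k) u v"
  shows "distance n P A u v \<le> 2"
  using assms
proof (induction ps arbitrary: Ss k)
  case Nil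
  then show ?case by simp
next
  case (Cons p ps)
  have first: "step approx n l P A p (Ss ! 0) (Ss ! 1)"
    using Cons.prems(3)[of 0] Cons.prems(4) by simp
  show ?case
  proof (cases k)
    case 0
    then show ?thesis
      using first Cons.prems(1,5) by simp
  next
    case (Suc k')
    obtain T Ts where Ss: "Ss = T # Ts"
      using Cons.prems(4) by (cases Ss) auto
    show ?thesis
    proof (rule Cons.IH[of Ts k'])
      show "safe ps J (Ts ! 0)"
        using first Cons.prems(1) Ss by simp
      show "step approx n l P A (ps ! i) (Ts ! i) (Ts ! Suc i)" if "Suc i < length Ts" for i
        using Cons.prems(3)[of "Suc i"] that Ss by simp
    qed (use Cons.prems Suc Ss in auto)
  qed
qed

section \<open>The operations preserve short edges\<close>

text \<open>
  \<open>D\<close> is the set of nodes that carry edges at the moment, and \<open>r\<close> the level at which distances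
  are measured. Edges of an eliminated node remain stored but are inert, so nothing is demanded of
  them.
\<close>

definition confined :: "nat \<Rightarrow> node set \<Rightarrow> 'a state \<Rightarrow> bool" where
  "confined r D S \<longleftrightarrow>
     (\<forall>u w. u \<notin> eliminated S \<longrightarrow> w \<notin> eliminated S \<longrightarrow> has_edge S u w \<longrightarrow>
        u \<in> D \<and> w \<in> D \<and> (anc r u, anc r w) \<in> near2 r)"

definition near_only :: "nat \<Rightarrow> node \<Rightarrow> 'a state \<Rightarrow> bool" where
  "near_only r v S \<longleftrightarrow>
     (\<forall>u. u \<notin> eliminated S \<longrightarrow> has_edge S u v \<or> has_edge S v u \<longrightarrow> (anc r v, anc r u) \<in> near r)"

lemma confined_mono: "confined r D S \<Longrightarrow> D \<subseteq> D' \<Longrightarrow> confined r D' S"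
  unfolding confined_def by blast

lemma confinedD:
  assumes "confined r D S" "u \<notin> eliminated S" "w \<notin> eliminated S" "has_edge S u w"
  shows "u \<in> D" "w \<in> D" "(anc r u, anc r w) \<in> near2 r"
  using assms unfolding confined_def by blast+

lemma eliminate_edge:
  assumes "has_edge (eliminate S v) u w" "\<not> has_edge S u w"
  shows "u \<in> in_neighbours S v" "w \<in> out_neighbours S v"
  using assms by (auto simp: eliminate_def has_edge_def split: if_splits)

lemma eliminated_eliminate: "eliminated (eliminate S v) = insert v (eliminated S)"
  by (simp add: eliminate_def)

text \<open>The triangle inequality through the pivot.\<close>

lemma fill_in_near2:
  assumes "near_only r v S" "u \<in> in_neighbours S v" "w \<in> out_neighbours S v"
  shows "(anc r u, anc r w) \<in> near2 r"
proof -
  have "(anc r v, anc r u) \<in> near r" "(anc r v, anc r w) \<in> near r"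
    using assms by (auto simp: near_only_def in_neighbours_def out_neighbours_def)
  then show ?thesis
    using near_sym by blast
qed

lemma confined_eliminate:
  assumes "confined r D S" "near_only r v S" "v \<notin> eliminated S"
  shows "confined r (D - {v}) (eliminate S v)"
  unfolding confined_def
proof (intro allI impI)
  fix u w
  assume live: "u \<notin> eliminated (eliminate S v)" "w \<notin> eliminated (eliminate S v)"
    and e: "has_edge (eliminate S v) u w"
  have uw: "u \<notin> eliminated S" "w \<notin> eliminated S" "u \<noteq> v" "w \<noteq> v"
    using live by (auto simp: eliminated_eliminate)
  show "u \<in> D - {v} \<and> w \<in> D - {v} \<and> (anc r u, anc r w) \<in> near2 r"
  proof (cases "has_edge S u w")
    case True
    then show ?thesis
      using confinedD[OF assms(1) uw(1,2)] uw by blast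
  next
    case False
    note nb = eliminate_edge[OF e False]
    then have "has_edge S u v" "has_edge S v w"
      by (auto simp: in_neighbours_def out_neighbours_def)
    then have "u \<in> D" "w \<in> D"
      using confinedD[OF assms(1)] assms(3) uw by blast+
    then show ?thesis
      using uw fill_in_near2[OF assms(2) nb] by blast
  qed
qed

text \<open>
  A node with the cluster of the pivot only gains neighbours of the pivot, which are as near to it
  as to the pivot.
\<close>

lemma near_only_eliminate:
  assumes "near_only r v S" "near_only r b S" "anc r b = anc r v"
  shows "near_only r b (eliminate S v)"
  unfolding near_only_def
proof (intro allI impI)
  fix u
  assume live: "u \<notin> eliminated (eliminate S v)"
    and e: "has_edge (eliminate S v) u b \<or> has_edge (eliminate S v) b u"
  have "u \<notin> eliminated S"
    using live by (simp add: eliminated_eliminate)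
  moreover have "has_edge S u b \<or> has_edge S b u \<or> has_edge S u v \<or> has_edge S v u"
    using e eliminate_edge by (fastforce simp: in_neighbours_def out_neighbours_def)
  ultimately show "(anc r b, anc r u) \<in> near r"
    using assms unfolding near_only_def by metis
qed

lemma merge_edge:
  assumes "has_edge (merge_red_nodes S s r0 r1) u w"
    and "u \<notin> eliminated S" "w \<notin> eliminated S"
  obtains u' w' where "u \<notin> {r0, r1}" "w \<notin> {r0, r1}" "has_edge S u' w'"
    "u' \<in> parts s r0 r1 u" "w' \<in> parts s r0 r1 w"
  using assms by (auto simp: merge_red_nodes_def has_edge_def split: if_splits)

lemma confined_merge:
  assumes "confined r D S" "r0 \<notin> eliminated S" "r1 \<notin> eliminated S"
    and "anc r r0 = anc r s" "anc r r1 = anc r s"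
  shows "confined r (insert s (D - {r0, r1})) (merge_red_nodes S s r0 r1)"
  unfolding confined_def
proof (intro allI impI)
  fix u w
  assume "u \<notin> eliminated (merge_red_nodes S s r0 r1)" "w \<notin> eliminated (merge_red_nodes S s r0 r1)"
  then have live: "u \<notin> eliminated S" "w \<notin> eliminated S"
    by (simp_all add: merge_red_nodes_def)
  assume "has_edge (merge_red_nodes S s r0 r1) u w"
  then obtain u' w' where uw: "u \<notin> {r0, r1}" "w \<notin> {r0, r1}" "has_edge S u' w'"
    "u' \<in> parts s r0 r1 u" "w' \<in> parts s r0 r1 w"
    using live merge_edge by metis
  have "u' \<notin> eliminated S" "w' \<notin> eliminated S" "anc r u' = anc r u" "anc r w' = anc r w"
    using uw(4,5) live assms by (auto simp: parts_def split: if_splits)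
  then show "u \<in> insert s (D - {r0, r1}) \<and> w \<in> insert s (D - {r0, r1}) \<and>
      (anc r u, anc r w) \<in> near2 r"
    using confinedD[OF assms(1) _ _ uw(3)] uw(1,2,4,5) by (auto simp: parts_def split: if_splits)
qed

lemma merge_creates:
  assumes "creates_edge S (merge_red_nodes S s r0 r1) u w"
  shows "u \<notin> eliminated S" "w \<notin> eliminated S" "u = s \<or> w = s"
proof -
  have no: "edge S u w = None" and new: "edge (merge_red_nodes S s r0 r1) u w \<noteq> None"
    using assms by (auto simp: creates_edge_def has_edge_def)
  then show live: "u \<notin> eliminated S" "w \<notin> eliminated S"
    by (auto simp: merge_red_nodes_def)
  have "has_edge (merge_red_nodes S s r0 r1) u w"
    using new by (simp add: has_edge_def)
  then show "u = s \<or> w = s"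
    using merge_edge[OF _ live] no by (metis (no_types) has_edge_def parts_def singletonD)
qed

lemma compressed_edge:
  assumes "has_edge (compressed S s b pb ps r R Q V) u w" "s \<notin> ps" "s \<noteq> pb"
  shows "has_edge S u w \<and> \<not> (u = s \<and> w \<in> ps \<or> u \<in> ps \<and> w = s) \<or>
    u = pb \<and> w \<in> ps \<or> u \<in> ps \<and> w = pb \<or> u \<in> {s, b, pb} \<and> w \<in> {s, b, pb}"
  using assms by (auto simp: compressed_def has_edge_def split: if_splits)

lemma eliminated_compressed: "eliminated (compressed S s b pb ps r R Q V) = eliminated S"
  by (simp add: compressed_def)

text \<open>
  The nodes \<open>s\<close>, \<open>b\<close> and \<open>pb\<close> correspond to one cluster, so an edge handed from \<open>s\<close> to
  \<open>pb\<close> keeps its distance.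
\<close>

lemma compressed_near2:
  assumes "confined r D S" "s \<notin> eliminated S"
    and "ps = well_separated_neighbours n l P A S s"
    and "anc r b = anc r s" "anc r pb = anc r s" "s \<noteq> pb"
    and "has_edge (compressed S s b pb ps m R Q V) u w" "\<not> has_edge S u w"
  shows "u \<in> D \<union> {s, b, pb} \<and> w \<in> D \<union> {s, b, pb} \<and> (anc r u, anc r w) \<in> near2 r"
proof -
  have handed: "p \<in> D \<and> (anc r pb, anc r p) \<in> near2 r \<and> (anc r p, anc r pb) \<in> near2 r"
    if "p \<in> ps" for p
  proof -
    have "p \<notin> eliminated S" "has_edge S s p \<or> has_edge S p s"
      using that assms(3) by (auto simp: well_separated_neighbours_def)
    then have "p \<in> D" "(anc r s, anc r p) \<in> near2 r"
      using confinedD[OF assms(1)] assms(2) near2_sym by blast+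
    then show ?thesis
      using assms(5) near2_sym by metis
  qed
  have "s \<notin> ps"
    using assms(3) by (simp add: well_separated_neighbours_def)
  then consider "u = pb" "w \<in> ps" | "u \<in> ps" "w = pb" | "u \<in> {s, b, pb}" "w \<in> {s, b, pb}"
    using compressed_edge[OF assms(7)] assms(6,8) by blast
  then show ?thesis
  proof cases
    case 1
    then show ?thesis
      using handed by blast
  next
    case 2
    then show ?thesis
      using handed by blast
  next
    case 3
    then have "anc r u = anc r w"
      using assms(4,5) by auto
    then show ?thesis
      using 3 near2_refl by auto
  qed
qed

lemma confined_compressed:
  assumes "confined r D S" "s \<notin> eliminated S"
    and "ps = well_separated_neighbours n l P A S s"
    and "anc r b = anc r s" "anc r pb = anc r s" "s \<noteq> pb"
  shows "confined r (D \<union> {s, b, pb}) (compressed S s b pb ps m R Q V)"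
  unfolding confined_def eliminated_compressed
  using compressed_near2[OF assms] confinedD[OF assms(1)] by (metis Un_iff)

text \<open>
  What is left at \<open>s\<close> is not well-separated from it, except perhaps a self-loop or the
  two new nodes when the diagonal block of the cluster vanishes. These are near because nearness is
  reflexive.
\<close>

lemma near_only_compressed:
  assumes "confined r D S" "s \<notin> eliminated S" "r \<le> l"
    and "ps = well_separated_neighbours n l P A S s"
    and "anc r b = anc r s" "anc r pb = anc r s" "s \<noteq> pb"
    and level: "\<And>v. v \<in> D \<Longrightarrow> cluster_level v = r \<and> cluster_index v < 2 ^ r"
  shows "near_only r s (compressed S s b pb ps m R Q V)"
  unfolding near_only_def eliminated_compressed
proof (intro allI impI)
  fix u
  assume u: "u \<notin> eliminated S"
    and e: "has_edge (compressed S s b pb ps m R Q V) u s \<or>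
      has_edge (compressed S s b pb ps m R Q V) s u"
  have "s \<notin> ps"
    using assms(4) by (simp add: well_separated_neighbours_def)
  then consider "u \<in> {s, b, pb}" | "has_edge S u s \<or> has_edge S s u" "u \<notin> ps" "u \<noteq> s"
    using e compressed_edge[of S s b pb ps m R Q V] assms(7) by blast
  then show "(anc r s, anc r u) \<in> near r"
  proof cases
    case 1
    then show ?thesis
      using assms(5,6) near_refl by auto
  next
    case 2
    then have "\<not> well_separated n l P A s u"
      using u assms(4) by (auto simp: well_separated_neighbours_def)
    moreover have "u \<in> D" "s \<in> D"
      using 2 confinedD[OF assms(1)] u assms(2) by blast+
    ultimately show ?thesis
      using near_if_not_well_separated level assms(3) by blast
  qed
qed

text \<open>As \<open>b\<close> has no edges before, it is joined only to \<open>s\<close> and \<open>pb\<close> afterwards.\<close>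

lemma near_only_compressed_black:
  assumes "confined r D S" "s \<notin> eliminated S" "b \<notin> eliminated S" "b \<notin> D"
    and "ps = well_separated_neighbours n l P A S s"
    and "anc r b = anc r s" "anc r pb = anc r s" "s \<noteq> pb" "b \<noteq> pb" "b \<noteq> s"
  shows "near_only r b (compressed S s b pb ps m R Q V)"
  unfolding near_only_def eliminated_compressed
proof (intro allI impI)
  fix u
  assume u: "u \<notin> eliminated S"
    and e: "has_edge (compressed S s b pb ps m R Q V) u b \<or>
      has_edge (compressed S s b pb ps m R Q V) b u"
  have "s \<notin> ps"
    using assms(5) by (simp add: well_separated_neighbours_def)
  moreover have "b \<notin> ps"
    using assms(1-5) confinedD(1,2)[OF assms(1)] by (auto simp: well_separated_neighbours_def)
  moreover have "\<not> has_edge S u b" "\<not> has_edge S b u"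
    using confinedD(1,2)[OF assms(1)] assms(3,4) u by blast+
  ultimately have "u \<in> {s, b, pb}"
    using e compressed_edge[of S s b pb ps m R Q V] assms(8,9) by blast
  then show "(anc r b, anc r u) \<in> near r"
    using assms(6,7) near_refl by auto
qed

section \<open>One level of the algorithm\<close>

text \<open>
  An upper bound for the set of eliminated nodes just before \<open>Super i j\<close> is compressed. It is
  tracked because \<open>confined\<close> says nothing about the edges of an eliminated node, so
  \<open>Super i j\<close> and \<open>Black i j\<close> must be known to be outside of it.
\<close>

definition processed :: "nat \<Rightarrow> nat \<Rightarrow> node set" where
  "processed i j =
     {v. \<exists>i' j'. (v = Super i' j' \<or> v = Black i' j') \<and> (i < i' \<or> i' = i \<and> j' < j)}"

text \<open>
  Super-nodes are formed in the order of their clusters, so the red-nodes not yet merged are those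
  whose parent cluster has number at least \<open>j\<close>. At \<open>j = 2 ^ r\<close> none is left, and all nodes with
  edges are of cluster level \<open>r\<close>.
\<close>

definition merge_nodes :: "nat \<Rightarrow> nat \<Rightarrow> node set" where
  "merge_nodes r j =
     {Red (Suc r) c |c. c < 2 ^ Suc r \<and> j \<le> anc r (Red (Suc r) c)} \<union> Super (Suc r) ` {..<j}"

definition sweep_nodes :: "nat \<Rightarrow> nat \<Rightarrow> node set" where
  "sweep_nodes r j = Super (Suc r) ` {j..<2 ^ r} \<union> Red r ` {..<j}"

definition level_start :: "nat \<Rightarrow> 'a state \<Rightarrow> bool" where
  "level_start r S \<longleftrightarrow> confined r (Red r ` {..<2 ^ r}) S \<and> eliminated S \<subseteq> processed r 0"

definition merge_inv :: "nat \<Rightarrow> nat \<Rightarrow> 'a state \<Rightarrow> bool" where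
  "merge_inv r j S \<longleftrightarrow> confined r (merge_nodes r j) S \<and> eliminated S \<subseteq> processed (Suc r) 0"

definition sweep_inv :: "nat \<Rightarrow> nat \<Rightarrow> 'a state \<Rightarrow> bool" where
  "sweep_inv r j S \<longleftrightarrow> confined r (sweep_nodes r j) S \<and> eliminated S \<subseteq> processed (Suc r) j"

lemma merge_inv_start:
  assumes "level_start (Suc r) S" "r < l"
  shows "merge_inv r 0 S"
proof -
  let ?D = "Red (Suc r) ` {..<2 ^ Suc r}"
  have conf: "confined (Suc r) ?D S" and el: "eliminated S \<subseteq> processed (Suc r) 0"
    using assms(1) by (auto simp: level_start_def)
  have "confined r ?D S"
    unfolding confined_def
  proof (intro allI impI)
    fix u w
    assume "u \<notin> eliminated S" "w \<notin> eliminated S" "has_edge S u w"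
    note uw = confinedD[OF conf this]
    then obtain c d where cd: "u = Red (Suc r) c" "w = Red (Suc r) d" "c < 2 ^ Suc r" "d < 2 ^ Suc r"
      by auto
    then have "(c, d) \<in> near2 (Suc r)"
      using uw(3) assms(2) by (simp add: anc_same_level)
    then show "u \<in> ?D \<and> w \<in> ?D \<and> (anc r u, anc r w) \<in> near2 r"
      using uw near2_coarsen[OF assms(2)] cd by blast
  qed
  then have "confined r (merge_nodes r 0) S"
    by (rule confined_mono) (auto simp: merge_nodes_def)
  with el show ?thesis
    by (simp add: merge_inv_def)
qed

lemma safe_merge:
  assumes "r < l" "j < 2 ^ r" "merge_inv r j S"
  shows "safe [MergeRedNodes (Suc r) j] (merge_inv r (Suc j)) S"
proof -
  let ?s = "Super (Suc r) j"
  have "(\<forall>u v. creates_edge S S' u v \<longrightarrow> distance n P A u v \<le> 2) \<and> merge_inv r (Suc j) S'"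
    if step: "step approx n l P A (MergeRedNodes (Suc r) j) S S'" for S'
  proof -
    obtain c0 c1 where ch: "are_children n P r j c0 c1"
      and S': "S' = merge_red_nodes S ?s (Red (Suc r) c0) (Red (Suc r) c1)"
      using step by cases auto
    let ?D = "insert ?s (merge_nodes r j - {Red (Suc r) c0, Red (Suc r) c1})"
    have "anc r ?s = j"
      using assms by (simp add: anc_same_level)
    moreover have "Red (Suc r) c \<notin> eliminated S" for c
      using assms(3) by (auto simp: merge_inv_def processed_def)
    ultimately have conf: "confined r ?D S'"
      unfolding S' using assms anc_child[OF ch assms(2,1)]
      by (intro confined_merge) (auto simp: merge_inv_def)
    have "c = c0 \<or> c = c1" if "c < 2 ^ Suc r" "anc r (Red (Suc r) c) = j" for c
      using child_cases[OF _ assms(1) that(1)] ch that(2) by simp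
    then have "?D \<subseteq> merge_nodes r (Suc j)"
      unfolding merge_nodes_def by (auto simp: Suc_le_eq order.strict_iff_order simp del: power_Suc)
    then have D: "confined r (merge_nodes r (Suc j)) S'"
      using conf confined_mono by blast
    have el: "eliminated S' = eliminated S"
      by (simp add: S' merge_red_nodes_def)
    have "distance n P A u v \<le> 2" if c: "creates_edge S S' u v" for u v
    proof -
      have uv: "u = ?s \<or> v = ?s" and "u \<notin> eliminated S'" "v \<notin> eliminated S'"
        using merge_creates[OF c[unfolded S']] by (auto simp: el)
      moreover have "has_edge S' u v"
        using c by (simp add: creates_edge_def)
      ultimately have uv': "u \<in> merge_nodes r (Suc j)" "v \<in> merge_nodes r (Suc j)"
        "(anc r u, anc r v) \<in> near2 r"
        using confinedD[OF D] by blast+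
      \<comment> \<open>One end is the super-node, so the distance is measured at level \<open>r\<close> even if the other end
        is a red-node not yet merged.\<close>
      then have "min (cluster_level u) (cluster_level v) = r"
        using uv by (auto simp: merge_nodes_def)
      then show ?thesis
        using uv'(3) by (rule distance_le_2)
    qed
    then show ?thesis
      using D assms(3) by (simp add: merge_inv_def el)
  qed
  then show ?thesis
    by simp
qed

lemma sweep_inv_start:
  assumes "r < l" "merge_inv r (2 ^ r) S"
  shows "sweep_inv r 0 S"
proof -
  have "merge_nodes r (2 ^ r) \<subseteq> sweep_nodes r 0"
    using anc_less[OF assms(1)] by (force simp: merge_nodes_def sweep_nodes_def)
  then show ?thesis
    using assms(2) confined_mono by (auto simp: merge_inv_def sweep_inv_def)
qed

lemma eliminate_distance:
  assumes "creates_edge S (eliminate S v) x y" "confined r D S" "near_only r v S" "v \<notin> eliminated S"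
    and "\<And>v. v \<in> D \<Longrightarrow> cluster_level v = r"
  shows "distance n P A x y \<le> 2"
proof -
  have nb: "x \<in> in_neighbours S v" "y \<in> out_neighbours S v"
    using eliminate_edge assms(1) by (auto simp: creates_edge_def)
  then have "x \<in> D" "y \<in> D"
    using confinedD[OF assms(2)] assms(4) by (auto simp: in_neighbours_def out_neighbours_def)
  then show ?thesis
    using fill_in_near2[OF assms(3) nb] assms(5) by (intro distance_le_2) auto
qed

lemma safe_sweep:
  assumes "r < l" "j < 2 ^ r" "sweep_inv r j S"
  shows "safe [Compress (Suc r) j, Eliminate (Super (Suc r) j), Eliminate (Black (Suc r) j)]
    (sweep_inv r (Suc j)) S"
proof -
  let ?s = "Super (Suc r) j" and ?b = "Black (Suc r) j" and ?p = "Red r j"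
  let ?D = "sweep_nodes r j \<union> {?s, ?b, ?p}"
  have conf: "confined r (sweep_nodes r j) S" and el: "eliminated S \<subseteq> processed (Suc r) j"
    using assms(3) by (auto simp: sweep_inv_def)
  have live: "?s \<notin> eliminated S" "?b \<notin> eliminated S"
    using el by (auto simp: processed_def)
  have anc: "anc r ?b = anc r ?s" "anc r ?p = anc r ?s"
    using assms by (simp_all add: anc_same_level)
  have level: "cluster_level v = r \<and> cluster_index v < 2 ^ r" if "v \<in> ?D" for v
    using that assms by (auto simp: sweep_nodes_def)
  have compress: "(\<forall>u v. creates_edge S S1 u v \<longrightarrow> distance n P A u v \<le> 2) \<and>
      confined r ?D S1 \<and> near_only r ?s S1 \<and> near_only r ?b S1 \<and> eliminated S1 = eliminated S"
    if step: "step approx n l P A (Compress (Suc r) j) S S1" for S1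
  proof -
    obtain ps m R Q V where ps: "set ps = well_separated_neighbours n l P A S ?s"
      and S1: "S1 = compressed S ?s ?b ?p (set ps) m R Q V"
      using step by cases auto
    have "distance n P A u v \<le> 2" if "creates_edge S S1 u v" for u v
    proof -
      have "u \<in> ?D \<and> v \<in> ?D \<and> (anc r u, anc r v) \<in> near2 r"
        using that compressed_near2[OF conf live(1) ps anc, of m R Q V u v]
        by (simp add: creates_edge_def S1)
      then show ?thesis
        using level by (intro distance_le_2) auto
    qed
    moreover have "confined r ?D S1"
      unfolding S1 by (intro confined_compressed[OF conf live(1) ps anc]) simp
    moreover have "near_only r ?s S1"
      unfolding S1 using assms(1) level by (intro near_only_compressed[OF conf live(1) _ ps anc]) auto
    moreover have "near_only r ?b S1"
      unfolding S1
      by (intro near_only_compressed_black[OF conf live _ ps anc]) (auto simp: sweep_nodes_def)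
    ultimately show ?thesis
      by (simp add: S1 eliminated_compressed)
  qed
  have super: "(\<forall>u v. creates_edge S1 S2 u v \<longrightarrow> distance n P A u v \<le> 2) \<and>
      confined r (?D - {?s}) S2 \<and> near_only r ?b S2 \<and> eliminated S2 = insert ?s (eliminated S)"
    if S1: "confined r ?D S1" "near_only r ?s S1" "near_only r ?b S1" "eliminated S1 = eliminated S"
      and step: "step approx n l P A (Eliminate ?s) S1 S2" for S1 S2
  proof -
    have S2: "S2 = eliminate S1 ?s"
      using step by cases auto
    have "distance n P A u v \<le> 2" if "creates_edge S1 S2 u v" for u v
      using that level S1 live by (intro eliminate_distance[of S1 ?s u v r ?D]) (auto simp: S2)
    moreover have "confined r (?D - {?s}) S2"
      unfolding S2 using S1 live by (intro confined_eliminate) auto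
    moreover have "near_only r ?b S2"
      unfolding S2 using S1 anc by (intro near_only_eliminate) auto
    ultimately show ?thesis
      using S1 by (simp add: S2 eliminated_eliminate)
  qed
  have black: "(\<forall>u v. creates_edge S2 S3 u v \<longrightarrow> distance n P A u v \<le> 2) \<and>
      sweep_inv r (Suc j) S3"
    if S2: "confined r (?D - {?s}) S2" "near_only r ?b S2" "eliminated S2 = insert ?s (eliminated S)"
      and step: "step approx n l P A (Eliminate ?b) S2 S3" for S2 S3
  proof -
    have S3: "S3 = eliminate S2 ?b"
      using step by cases auto
    have "?b \<notin> eliminated S2"
      using S2(3) live by simp
    then have "confined r (?D - {?s} - {?b}) S3"
      unfolding S3 using S2 by (intro confined_eliminate)
    moreover have "?D - {?s} - {?b} \<subseteq> sweep_nodes r (Suc j)"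
      by (auto simp: sweep_nodes_def image_iff Suc_le_eq nat_less_le)
    ultimately have "confined r (sweep_nodes r (Suc j)) S3"
      using confined_mono by blast
    moreover have "eliminated S3 \<subseteq> processed (Suc r) (Suc j)"
    proof -
      have "processed (Suc r) j \<subseteq> processed (Suc r) (Suc j)"
        "?s \<in> processed (Suc r) (Suc j)" "?b \<in> processed (Suc r) (Suc j)"
        by (auto simp: processed_def)
      then show ?thesis
        using el S2(3) by (auto simp: S3 eliminated_eliminate)
    qed
    moreover have "distance n P A u v \<le> 2" if "creates_edge S2 S3 u v" for u v
      using that level S2 \<open>?b \<notin> eliminated S2\<close>
      by (intro eliminate_distance[of S2 ?b u v r "?D - {?s}"]) (auto simp: S3)
    ultimately show ?thesis
      by (simp add: sweep_inv_def)
  qed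
  show ?thesis
  proof (rule safe_Cons[OF compress])
    fix S1
    assume S1: "confined r ?D S1 \<and> near_only r ?s S1 \<and> near_only r ?b S1 \<and>
      eliminated S1 = eliminated S"
    show "safe [Eliminate ?s, Eliminate ?b] (sweep_inv r (Suc j)) S1"
    proof (rule safe_Cons[OF super])
      fix S2
      assume S2: "confined r (?D - {?s}) S2 \<and> near_only r ?b S2 \<and>
        eliminated S2 = insert ?s (eliminated S)"
      show "safe [Eliminate ?b] (sweep_inv r (Suc j)) S2"
      proof (rule safe_Cons[OF black])
        show "safe [] (sweep_inv r (Suc j)) S3" if "sweep_inv r (Suc j) S3" for S3
          using that by simp
      qed (use S2 in blast)+
    qed (use S1 in blast)+
  qed
qed

lemma level_start_next:
  assumes "sweep_inv r (2 ^ r) S"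
  shows "level_start r S"
proof -
  have "sweep_nodes r (2 ^ r) = Red r ` {..<2 ^ r}"
    by (auto simp: sweep_nodes_def)
  moreover have "processed (Suc r) (2 ^ r) \<subseteq> processed r 0"
    by (auto simp: processed_def)
  ultimately show ?thesis
    using assms by (auto simp: sweep_inv_def level_start_def)
qed

section \<open>The whole algorithm\<close>

definition level_ops :: "nat \<Rightarrow> operation list" where
  "level_ops i =
     map (MergeRedNodes i) [0..<2 ^ (i - 1)] @
     concat (map (\<lambda>j. [Compress i j, Eliminate (Super i j), Eliminate (Black i j)])
       [0..<2 ^ (i - 1)])"

lemma safe_level:
  assumes "r < l" "level_start (Suc r) S"
  shows "safe (level_ops (Suc r)) (level_start r) S"
proof -
  have "safe (concat (map (\<lambda>j. [MergeRedNodes (Suc r) j]) [0..<2 ^ r])) (merge_inv r (2 ^ r)) S"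
    using safe_merge assms merge_inv_start by (intro safe_loop) auto
  then have "safe (map (MergeRedNodes (Suc r)) [0..<2 ^ r]) (merge_inv r (2 ^ r)) S"
    by (simp only: concat_map_singleton)
  moreover have "safe (concat (map (\<lambda>j. [Compress (Suc r) j, Eliminate (Super (Suc r) j),
      Eliminate (Black (Suc r) j)]) [0..<2 ^ r])) (level_start r) S'"
    if "merge_inv r (2 ^ r) S'" for S'
    by (rule safe_mono[OF safe_loop[where I = "sweep_inv r"] level_start_next])
      (use safe_sweep assms sweep_inv_start that in blast)+
  ultimately show ?thesis
    unfolding level_ops_def by (auto simp: safe_append intro: safe_mono)
qed

lemma safe_schedule:
  assumes "level_start r S" "r \<le> l"
  shows "safe (schedule r) (level_start 0) S"
  using assms
proof (induction r arbitrary: S)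
  case 0
  then show ?case by (simp add: schedule_def)
next
  case (Suc r)
  have "schedule (Suc r) = level_ops (Suc r) @ schedule r"
    by (simp add: schedule_def level_ops_def)
  then show ?case
    using safe_level[of r S] Suc by (auto simp: safe_append intro: safe_mono)
qed

lemma level_start_initial: "level_start l (initial_state n l P A)"
proof -
  have "u \<in> Red l ` {..<2 ^ l} \<and> w \<in> Red l ` {..<2 ^ l} \<and> (anc l u, anc l w) \<in> near2 l"
    if e: "initial_edge n l P A u w \<noteq> None" for u w
  proof -
    obtain p q where pq: "u = Red l p" "w = Red l q" "(p, q) \<in> adjacency_graph n P A l"
      using e by (cases u; cases w)
        (auto split: if_splits)
    then have "p < 2 ^ l" "q < 2 ^ l" "(p, q) \<in> near2 l"
      by (auto simp: adjacency_graph_def near_def)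
    then show ?thesis
      using pq by (auto simp: anc_same_level)
  qed
  then show ?thesis
    by (simp add: level_start_def confined_def initial_state_def has_edge_def)
qed

end

theorem theorem5p3:
  fixes A :: "'a::field mat"
    and P :: "nat \<Rightarrow> nat \<Rightarrow> nat"
    and n l :: nat
    and approx :: "'a mat \<Rightarrow> 'a mat \<Rightarrow> bool"
    and Ss :: "'a state list"
  assumes "A \<in> carrier_mat n n"
    and "nested_partitionings n l P"
    and "execution approx n l P A Ss"
  shows "\<not> (\<exists>k u v. Suc k < length Ss \<and> creates_edge (Ss ! k) (Ss ! Suc k) u v \<and>
                  distance n P A u v > 2)"
proof -
  interpret nested_matrix n l P A approx
    using assms by unfold_locales
  have "Ss ! 0 = initial_state n l P A"
    using assms(3) by (auto simp: execution_def hd_conv_nth)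
  then have "safe (schedule l) (level_start 0) (Ss ! 0)"
    using safe_schedule[OF level_start_initial] by simp
  then have "distance n P A u v \<le> 2"
    if "Suc k < length Ss" "creates_edge (Ss ! k) (Ss ! Suc k) u v" for k u v
    using safe_run that assms(3) unfolding execution_def by blast
  then show ?thesis
    by (meson not_less)
qed

end
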